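(* Consider the time semi-discrete scheme which, for $n=0,1,2,\dots$ and given $(\rho^n,\mathbf u^n)$, determines the stages $(\rho^i,\mathbf u^i)$, $i=1,\dots,s$, by $$\rho^{i}=\rho^n - \Delta t_n \sum_{j=1}^{i-1} a_{ij} \nabla \cdot (\rho \mathbf{u})^{j} - \Delta t_n a_{ii} \nabla \cdot (\rho \mathbf{u})^{n} + \Delta t_n^2 a_{ii} \sum_{j=1}^{i-1} \tilde{a}_{ij} \nabla^2 : (\rho \mathbf{u} \otimes \mathbf{u} )^{j} + \frac{\Delta t_n^2}{\epsilon^2} a_{ii} \sum_{j=1}^i a_{ij} \Delta p(\rho)^{j},$$ $$(\rho \mathbf{u})^{i} = (\rho \mathbf{u})^{n} - \Delta t_n \sum_{j=1}^{i-1} \tilde{a}_{ij} \nabla \cdot (\rho \mathbf{u} \otimes \mathbf{u} )^{j} - \frac{\Delta t_n}{\epsilon^2} \sum_{j=1}^i a_{ij} \nabla p(\rho)^{j},$$ and sets $(\rho^{n+1},\mathbf u^{n+1})=(\rho^s,\mathbf u^s)$, where $(\tilde a_{ij}),(a_{ij})$ are the coefficient matrices of a globally stiffly accurate IMEX-RK scheme with $s$ stages. Assume that $\rho$ and $\mathbf u$ satisfy periodic boundary conditions, that the initial conditions are well-prepared, i.e. $$\rho(\mathbf x,0)=\rho_{(0)}^0+\epsilon^2\rho_{(2)}^0(\mathbf x),\qquad \mathbf u(\mathbf x,0)=\mathbf u_{(0)}^0(\mathbf x)+\epsilon\,\mathbf u_{(1)}^0(\mathbf x),$$ with $\rho_{(0)}^0$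 constant and $\nabla\cdot\mathbf u_{(0)}^0=0$, and that $\rho,\mathbf u,p$ at all time levels and stages admit the asymptotic expansions $$\rho=\rho_{(0)}+\epsilon\rho_{(1)}+\epsilon^2\rho_{(2)}+\dots,\quad \mathbf u=\mathbf u_{(0)}+\epsilon\mathbf u_{(1)}+\epsilon^2\mathbf u_{(2)}+\dots,\quad p=p_{(0)}+\epsilon p_{(1)}+\epsilon^2p_{(2)}+\dots$$ Then, for $\epsilon\to0$ (that is, upon balancing equal powers of $\epsilon$), the scheme satisfies for all $i\in\{1,2,\dots,s\}$ (and every $n$) $$\rho_{(0)}^i\equiv\text{constant},\qquad \rho_{(1)}^i\equiv\text{constant},\qquad \rho_{(0)}^i+\epsilon\rho_{(1)}^i=\rho_0,$$ $$\nabla\cdot\mathbf u_{(0)}^i=0,$$ $$\mathbf u_{(0)}^i=\mathbf u_{(0)}^n-\Delta t_n\sum_{j=1}^{i-1}\tilde a_{ij}\nabla\cdot(\mathbf u_{(0)}\otimes\mathbf u_{(0)})^j-\frac{\Delta t_n}{\rho_0}\sum_{j=1}^i a_{ij}\nabla p_{(2)}^j,$$ where $\rho_0:=\rho_{(0)}^0+\epsilon\rho_{(1)}^0$ is the constant given by the initial data. This is a consistent approximation of the incompressible Euler system $$\partial_t\rho_{(0)}+\rho_{(0)}\nabla\cdot\mathbf u_{(0)}=0,\qquad \partial_t(\rho_{(0)}\mathbf u_{(0)})+\rho_{(0)}\nabla\cdot(\mathbf u_{(0)}\otimes\mathbf u_{(0)})+\nabla p_{(2)}=\mathbf 0$$ (with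 $\rho_{(0)}$ constant in space and time, so that $\nabla\cdot\mathbf u_{(0)}=0$).
   Context: The scheme discretises in time the dimensionless barotropic Euler system on $\Omega\subset\mathbb R^d$ (here with periodic boundary conditions), $$\partial_t\rho+\nabla\cdot(\rho\mathbf u)=0,\qquad \partial_t(\rho\mathbf u)+\nabla\cdot(\rho\mathbf u\otimes\mathbf u)+\frac1{\epsilon^2}\nabla p(\rho)=\mathbf 0,$$ with density $\rho>0$, velocity $\mathbf u\in\mathbb R^d$, pressure $p(\rho)=\kappa\rho^\gamma$, constants $\kappa>0$, $\gamma>1$, and $\epsilon>0$ proportional to the Mach number. Notation. $\Delta t_n=t_{n+1}-t_n>0$. A superscript $n$ denotes the value at time level $t_n$, a superscript $i$ or $j$ (as a stage index) the value at that stage of the current step; $(\rho\mathbf u)^j=\rho^j\mathbf u^j$, $p(\rho)^j=p(\rho^j)$, etc. A superscript $0$ on expansion coefficients of initial data denotes the initial time. $\Delta$ without subscript is the Laplacian and $\nabla^2:(\rho\mathbf u\otimes\mathbf u)=\nabla\cdot(\nabla\cdot(\rho\mathbf u\otimes\mathbf u))$. A parenthesised subscript $(m)$ denotes the coefficient of $\epsilon^m$ in the asymptotic expansion; the expansion of $p$ is that of $\kappa\rho^\gamma$, so in particular $p_{(0)}=\kappa\rho_{(0)}^\gamma$. All asymptotics is formal: functions are assumed sufficiently regular, expansions are inserted into the scheme and terms with equal powers of $\epsilon$ are equated. IMEX-RK scheme. It is given by matrices $\tilde A=(\tilde a_{ij}),A=(a_{ij})\in\mathbb R^{s\times s}$ and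 vectors $\tilde b,b,\tilde c,c\in\mathbb R^s$, where $\tilde A$ is strictly lower triangular (explicit part), $A$ is lower triangular with non-zero diagonal entries (diagonally implicit part), $\tilde c_i=\sum_{j=1}^{i-1}\tilde a_{ij}$ and $c_i=\sum_{j=1}^i a_{ij}$. It is globally stiffly accurate (GSA) if $c_s=\tilde c_s=1$ and $a_{sj}=b_j$, $\tilde a_{sj}=\tilde b_j$ for all $j\in\{1,\dots,s\}$; hence the update at $t_{n+1}$ equals the $s$-th stage. "Consistent approximation" means that the limiting stage relations are those of the same IMEX-RK scheme applied to the limiting incompressible system, with the convective term treated by $(\tilde a_{ij})$ and the pressure gradient and the divergence constraint treated implicitly. *)

theory Defs
  imports "HOL-Analysis.Analysis" "HOL-Computational_Algebra.Formal_Laurent_Series"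
begin

section \<open>Differential operators on \<open>\<real>\<^sup>d\<close>\<close>

definition partial :: "'d::finite \<Rightarrow> (real^'d \<Rightarrow> real) \<Rightarrow> real^'d \<Rightarrow> real" where
  "partial k g x = frechet_derivative g (at x) (axis k 1)"

definition grad :: "(real^'d::finite \<Rightarrow> real) \<Rightarrow> real^'d \<Rightarrow> real^'d" where
  "grad g x = (\<chi> k. partial k g x)"

definition divergence :: "(real^'d::finite \<Rightarrow> real^'d) \<Rightarrow> real^'d \<Rightarrow> real" where
  "divergence F x = (\<Sum>k\<in>UNIV. partial k (\<lambda>y. F y $ k) x)"

definition tensor_divergence :: "(real^'d::finite \<Rightarrow> real^'d^'d) \<Rightarrow> real^'d \<Rightarrow> real^'d" where
  "tensor_divergence T x = (\<chi> k. divergence (\<lambda>y. \<chi> l. T y $ l $ k) x)"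

definition outer :: "'a::times^'d \<Rightarrow> 'a^'d \<Rightarrow> 'a^'d^'d" (infixl \<open>\<otimes>\<^sub>v\<close> 70) where
  "v \<otimes>\<^sub>v w = (\<chi> k l. v $ k * w $ l)"

fun C_k :: "nat \<Rightarrow> (real^'d::finite \<Rightarrow> real) \<Rightarrow> bool" where
  "C_k 0 g = continuous_on UNIV g"
| "C_k (Suc m) g = (g differentiable_on UNIV \<and> (\<forall>k. C_k m (partial k g)))"

definition periodic :: "real^'d::finite \<Rightarrow> (real^'d \<Rightarrow> 'a) \<Rightarrow> bool" where
  "periodic L f \<longleftrightarrow> (\<forall>x k. f (x + axis k (L $ k)) = f x)"


section \<open>Asymptotic expansions as formal power series in \<open>\<epsilon>\<close>\<close>

text \<open>
  The asymptotics is formal: a field with an expansion \<open>f\<^sub>0 + \<epsilon> f\<^sub>1 + \<epsilon>\<^sup>2 f\<^sub>2 + \<dots>\<close> is a function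
  into the formal power series, with \<open>f\<^sub>m\<close> the \<open>m\<close>-th coefficient function.  Spatial derivatives
  act coefficientwise.
\<close>

definition scoeff :: "nat \<Rightarrow> (real^'d \<Rightarrow> real fps) \<Rightarrow> real^'d \<Rightarrow> real" where
  "scoeff m f x = fps_nth (f x) m"

definition vcoeff :: "nat \<Rightarrow> (real^'d \<Rightarrow> (real fps)^'d) \<Rightarrow> real^'d \<Rightarrow> real^'d" where
  "vcoeff m F x = (\<chi> k. fps_nth (F x $ k) m)"

definition tcoeff :: "nat \<Rightarrow> (real^'d \<Rightarrow> (real fps)^'d^'d) \<Rightarrow> real^'d \<Rightarrow> real^'d^'d" where
  "tcoeff m T x = (\<chi> k l. fps_nth (T x $ k $ l) m)"

definition fgrad :: "(real^'d::finite \<Rightarrow> real fps) \<Rightarrow> real^'d \<Rightarrow> (real fps)^'d" where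
  "fgrad f x = (\<chi> k. Abs_fps (\<lambda>m. grad (scoeff m f) x $ k))"

definition fdiv :: "(real^'d::finite \<Rightarrow> (real fps)^'d) \<Rightarrow> real^'d \<Rightarrow> real fps" where
  "fdiv F x = Abs_fps (\<lambda>m. divergence (vcoeff m F) x)"

definition ftdiv :: "(real^'d::finite \<Rightarrow> (real fps)^'d^'d) \<Rightarrow> real^'d \<Rightarrow> (real fps)^'d" where
  "ftdiv T x = (\<chi> k. Abs_fps (\<lambda>m. tensor_divergence (tcoeff m T) x $ k))"

definition flaplacian :: "(real^'d::finite \<Rightarrow> real fps) \<Rightarrow> real^'d \<Rightarrow> real fps" where
  "flaplacian f x = fdiv (fgrad f) x"

definition regular_scalar :: "(real^'d::finite \<Rightarrow> real fps) \<Rightarrow> bool" where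
  "regular_scalar f \<longleftrightarrow> (\<forall>m. C_k 2 (scoeff m f))"

definition regular_vector :: "(real^'d::finite \<Rightarrow> (real fps)^'d) \<Rightarrow> bool" where
  "regular_vector F \<longleftrightarrow> (\<forall>m k. C_k 2 (\<lambda>x. vcoeff m F x $ k))"

text \<open>
  Expansion of \<open>\<kappa> r\<^sup>\<gamma>\<close> for a series \<open>r\<close> with \<open>r\<^sub>0 > 0\<close>, as
  \<open>\<kappa> r\<^sub>0\<^sup>\<gamma> (1 + z)\<^sup>\<gamma>\<close> with \<open>z = r / r\<^sub>0 - 1\<close>, where \<open>(1 + z)\<^sup>\<gamma>\<close> is the binomial series
  composed with \<open>z\<close> (which has no constant term).
\<close>

definition pressure :: "real \<Rightarrow> real \<Rightarrow> real fps \<Rightarrow> real fps" where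
  "pressure \<kappa> \<gamma> r =
     fps_const (\<kappa> * fps_nth r 0 powr \<gamma>) *
     fps_compose (fps_binomial \<gamma>) (fps_const (inverse (fps_nth r 0)) * r - 1)"

lemma pressure_nth_0: "fps_nth (pressure \<kappa> \<gamma> r) 0 = \<kappa> * fps_nth r 0 powr \<gamma>"
  by (simp add: pressure_def)


section \<open>IMEX Runge--Kutta schemes\<close>

text \<open>
  Stage indices run over \<open>1, \<dots>, s\<close>; \<open>At, bt, ct\<close> are the explicit coefficients (those written with
  a tilde), \<open>A, b, c\<close> the implicit ones.
\<close>

definition imex_rk :: "nat \<Rightarrow> (nat \<Rightarrow> nat \<Rightarrow> real) \<Rightarrow> (nat \<Rightarrow> nat \<Rightarrow> real) \<Rightarrow>
    (nat \<Rightarrow> real) \<Rightarrow> (nat \<Rightarrow> real) \<Rightarrow> bool" where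
  "imex_rk s At A ct c \<longleftrightarrow>
     1 \<le> s \<and>
     (\<forall>i\<in>{1..s}. \<forall>j\<in>{1..s}. i \<le> j \<longrightarrow> At i j = 0) \<and>
     (\<forall>i\<in>{1..s}. \<forall>j\<in>{1..s}. i < j \<longrightarrow> A i j = 0) \<and>
     (\<forall>i\<in>{1..s}. A i i \<noteq> 0) \<and>
     (\<forall>i\<in>{1..s}. ct i = (\<Sum>j=1..<i. At i j)) \<and>
     (\<forall>i\<in>{1..s}. c i = (\<Sum>j=1..i. A i j))"

definition globally_stiffly_accurate :: "nat \<Rightarrow> (nat \<Rightarrow> nat \<Rightarrow> real) \<Rightarrow> (nat \<Rightarrow> nat \<Rightarrow> real) \<Rightarrow>
    (nat \<Rightarrow> real) \<Rightarrow> (nat \<Rightarrow> real) \<Rightarrow> (nat \<Rightarrow> real) \<Rightarrow> (nat \<Rightarrow> real) \<Rightarrow> bool" where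
  "globally_stiffly_accurate s At A bt b ct c \<longleftrightarrow>
     c s = 1 \<and> ct s = 1 \<and> (\<forall>j\<in>{1..s}. A s j = b j \<and> At s j = bt j)"

text \<open>
  One step of size \<open>h\<close> from \<open>y0\<close> to \<open>y1\<close> with stages \<open>Y\<close>, where \<open>F j\<close> and \<open>G j\<close> are the values at
  stage \<open>j\<close> of the explicitly and of the implicitly treated part of the right-hand side.
\<close>

definition imex_rk_step :: "nat \<Rightarrow> (nat \<Rightarrow> nat \<Rightarrow> real) \<Rightarrow> (nat \<Rightarrow> nat \<Rightarrow> real) \<Rightarrow>
    (nat \<Rightarrow> real) \<Rightarrow> (nat \<Rightarrow> real) \<Rightarrow> real \<Rightarrow>
    'v::real_vector \<Rightarrow> (nat \<Rightarrow> 'v) \<Rightarrow> (nat \<Rightarrow> 'v) \<Rightarrow> (nat \<Rightarrow> 'v) \<Rightarrow> 'v \<Rightarrow> bool" where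
  "imex_rk_step s At A bt b h y0 Y F G y1 \<longleftrightarrow>
     (\<forall>i\<in>{1..s}. Y i = y0 + h *\<^sub>R (\<Sum>j=1..<i. At i j *\<^sub>R F j) + h *\<^sub>R (\<Sum>j=1..i. A i j *\<^sub>R G j)) \<and>
     y1 = y0 + h *\<^sub>R (\<Sum>j=1..s. bt j *\<^sub>R F j) + h *\<^sub>R (\<Sum>j=1..s. b j *\<^sub>R G j)"


section \<open>The semi-discrete scheme and its limit\<close>

text \<open>
  The scheme contains negative powers of \<open>\<epsilon>\<close>, so its equations are identities between formal
  Laurent series in \<open>\<epsilon> = fls_X\<close>; equality of these is balancing of equal powers of \<open>\<epsilon>\<close>.
  \<open>rn, un\<close> are the data at time level \<open>n\<close>, \<open>r j, u j\<close> the stage values.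
\<close>

definition density_stage :: "(nat \<Rightarrow> nat \<Rightarrow> real) \<Rightarrow> (nat \<Rightarrow> nat \<Rightarrow> real) \<Rightarrow> real \<Rightarrow> real \<Rightarrow> real \<Rightarrow>
    (real^'d::finite \<Rightarrow> real fps) \<Rightarrow> (real^'d \<Rightarrow> (real fps)^'d) \<Rightarrow>
    (nat \<Rightarrow> real^'d \<Rightarrow> real fps) \<Rightarrow> (nat \<Rightarrow> real^'d \<Rightarrow> (real fps)^'d) \<Rightarrow> nat \<Rightarrow> bool" where
  "density_stage At A \<kappa> \<gamma> h rn un r u i \<longleftrightarrow> (\<forall>x.
     fps_to_fls (r i x) =
       fps_to_fls (rn x)
       - fls_const h * (\<Sum>j=1..<i. fls_const (A i j) * fps_to_fls (fdiv (\<lambda>y. r j y *s u j y) x))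
       - fls_const h * fls_const (A i i) * fps_to_fls (fdiv (\<lambda>y. rn y *s un y) x)
       + fls_const (h^2) * fls_const (A i i) *
           (\<Sum>j=1..<i. fls_const (At i j) *
              fps_to_fls (fdiv (ftdiv (\<lambda>y. (r j y *s u j y) \<otimes>\<^sub>v u j y)) x))
       + fls_const (h^2) / fls_X^2 * fls_const (A i i) *
           (\<Sum>j=1..i. fls_const (A i j) *
              fps_to_fls (flaplacian (\<lambda>y. pressure \<kappa> \<gamma> (r j y)) x)))"

definition momentum_stage :: "(nat \<Rightarrow> nat \<Rightarrow> real) \<Rightarrow> (nat \<Rightarrow> nat \<Rightarrow> real) \<Rightarrow> real \<Rightarrow> real \<Rightarrow> real \<Rightarrow>
    (real^'d::finite \<Rightarrow> real fps) \<Rightarrow> (real^'d \<Rightarrow> (real fps)^'d) \<Rightarrow>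
    (nat \<Rightarrow> real^'d \<Rightarrow> real fps) \<Rightarrow> (nat \<Rightarrow> real^'d \<Rightarrow> (real fps)^'d) \<Rightarrow> nat \<Rightarrow> bool" where
  "momentum_stage At A \<kappa> \<gamma> h rn un r u i \<longleftrightarrow> (\<forall>x k.
     fps_to_fls ((r i x *s u i x) $ k) =
       fps_to_fls ((rn x *s un x) $ k)
       - fls_const h * (\<Sum>j=1..<i. fls_const (At i j) *
           fps_to_fls (ftdiv (\<lambda>y. (r j y *s u j y) \<otimes>\<^sub>v u j y) x $ k))
       - fls_const h / fls_X^2 * (\<Sum>j=1..i. fls_const (A i j) *
           fps_to_fls (fgrad (\<lambda>y. pressure \<kappa> \<gamma> (r j y)) x $ k)))"

text \<open>
  One step of the IMEX-RK scheme applied to the incompressible Euler system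
  \<open>\<partial>\<^sub>t r + r \<nabla>\<cdot>u = 0\<close>, \<open>\<partial>\<^sub>t (r u) + r \<nabla>\<cdot>(u \<otimes> u) + \<nabla>q = 0\<close> with \<open>r\<close> constant in space and time
  (value \<open>C\<close>), so that \<open>\<nabla>\<cdot>u = 0\<close>.  Convection is explicit, \<open>\<nabla>q\<close> and \<open>\<nabla>\<cdot>u\<close> are implicit.
\<close>

definition imex_rk_incompressible_Euler :: "nat \<Rightarrow> (nat \<Rightarrow> nat \<Rightarrow> real) \<Rightarrow> (nat \<Rightarrow> nat \<Rightarrow> real) \<Rightarrow>
    (nat \<Rightarrow> real) \<Rightarrow> (nat \<Rightarrow> real) \<Rightarrow> real \<Rightarrow> real \<Rightarrow>
    (real^'d::finite \<Rightarrow> real) \<Rightarrow> (real^'d \<Rightarrow> real^'d) \<Rightarrow>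
    (nat \<Rightarrow> real^'d \<Rightarrow> real) \<Rightarrow> (nat \<Rightarrow> real^'d \<Rightarrow> real^'d) \<Rightarrow> (nat \<Rightarrow> real^'d \<Rightarrow> real) \<Rightarrow>
    (real^'d \<Rightarrow> real) \<Rightarrow> (real^'d \<Rightarrow> real^'d) \<Rightarrow> bool" where
  "imex_rk_incompressible_Euler s At A bt b h C rn un r u q rn1 un1 \<longleftrightarrow> (\<forall>x.
     rn x = C \<and> rn1 x = C \<and> (\<forall>i\<in>{1..s}. r i x = C) \<and>
     divergence un x = 0 \<and> divergence un1 x = 0 \<and> (\<forall>i\<in>{1..s}. divergence (u i) x = 0) \<and>
     imex_rk_step s At A bt b h (rn x) (\<lambda>i. r i x)
       (\<lambda>j. 0) (\<lambda>j. - (r j x * divergence (u j) x)) (rn1 x) \<and>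
     imex_rk_step s At A bt b h (rn x *\<^sub>R un x) (\<lambda>i. r i x *\<^sub>R u i x)
       (\<lambda>j. - (r j x *\<^sub>R tensor_divergence (\<lambda>y. u j y \<otimes>\<^sub>v u j y) x))
       (\<lambda>j. - grad (q j) x) (rn1 x *\<^sub>R un1 x))"

end

theory Submission
  imports Defs
begin

text \<open>
  Write \<open>M\<^sup>j = (\<rho>u)\<^sup>j\<close> and let a subscript denote the order in \<open>\<epsilon>\<close>.  The momentum stages contain
  \<open>\<epsilon>\<^sup>-\<^sup>2 \<Sum>\<^sub>j\<^sub>\<le>\<^sub>i a\<^sub>i\<^sub>j \<nabla>p\<^sup>j\<close>, so at orders \<open>-2\<close> and \<open>-1\<close> they say that the lower triangular system
  \<open>\<Sum>\<^sub>j\<^sub>\<le>\<^sub>i a\<^sub>i\<^sub>j \<nabla>p\<^sub>m\<^sup>j = 0\<close> holds for \<open>m = 0, 1\<close>.  As \<open>a\<^sub>i\<^sub>i \<noteq> 0\<close>, all \<open>p\<^sub>0\<^sup>i\<close> and \<open>p\<^sub>1\<^sup>i\<close> are constant in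
  space; \<open>p\<^sub>0 = \<kappa>\<rho>\<^sub>0\<^sup>\<gamma>\<close> and \<open>p\<^sub>1 = \<kappa>\<gamma>\<rho>\<^sub>0\<^sup>\<gamma>\<^sup>-\<^sup>1\<rho>\<^sub>1\<close> then make \<open>\<rho>\<^sub>0\<^sup>i\<close> and \<open>\<rho>\<^sub>1\<^sup>i\<close> constant in space
  (\<open>leading_density_constant\<close>, \<open>first_order_density_constant\<close>).

  The terms of the density stage carrying the factor \<open>a\<^sub>i\<^sub>i\<close> are \<open>-h a\<^sub>i\<^sub>i\<close> times the divergence of the
  right-hand side of the momentum stage.  Inserting the latter turns the density stage, at every
  order \<open>m \<ge> 0\<close>, into \<open>\<rho>\<^sub>m\<^sup>i = \<rho>\<^sub>m\<^sup>n - h \<Sum>\<^sub>j\<^sub>\<le>\<^sub>i a\<^sub>i\<^sub>j \<nabla>\<cdot>M\<^sub>m\<^sup>j\<close> (\<open>mass_balance\<close>).  A periodic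
  \<open>C\<^sup>1\<close> field whose divergence is constant is divergence-free, by integration over a period cell
  (\<open>constant_divergence_periodic\<close>).  Hence, for \<open>m = 0, 1\<close>, a density coefficient that is constant in
  space keeps its value from time level \<open>n\<close> (\<open>constant_density_conserved\<close>).  With \<open>\<rho>\<^sub>0\<^sup>i = \<rho>\<^sub>0\<^sup>n\<close> the mass
  balance for \<open>m = 0\<close> is again a homogeneous lower triangular system, now for \<open>\<nabla>\<cdot>M\<^sub>0\<^sup>j\<close>, which gives
  \<open>\<nabla>\<cdot>u\<^sub>0\<^sup>i = 0\<close>.  The order \<open>0\<close> part of the momentum stage is the limiting velocity equation.
  Induction on \<open>n\<close> carries the density values from one time level to the next, since by global
  stiff accuracy the new time level is the last stage.
\<close>

section \<open>Calculus of partial derivatives\<close>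

lemma partial_eq:
  assumes "(g has_derivative g') (at x)"
  shows "partial k g x = g' (axis k 1)"
  using frechet_derivative_at[OF assms] by (simp add: partial_def)

lemma partial_const [simp]: "partial k (\<lambda>x. c) x = 0"
  by (rule partial_eq[THEN trans]) (auto intro!: derivative_eq_intros)

lemma partial_add:
  assumes "f differentiable at x" "g differentiable at x"
  shows "partial k (\<lambda>y. f y + g y) x = partial k f x + partial k g x"
  using assms unfolding frechet_derivative_works
  by (subst partial_eq[OF has_derivative_add]) (auto simp: partial_def)

lemma partial_mult:
  fixes f g :: "real^'d::finite \<Rightarrow> real"
  assumes "f differentiable at x" "g differentiable at x"
  shows "partial k (\<lambda>y. f y * g y) x = f x * partial k g x + partial k f x * g x"
  using assms unfolding frechet_derivative_works
  by (subst partial_eq[OF has_derivative_mult]) (auto simp: partial_def)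

lemma partial_scale:
  fixes f :: "real^'d::finite \<Rightarrow> real"
  assumes "f differentiable at x"
  shows "partial k (\<lambda>y. c * f y) x = c * partial k f x"
  using assms by (subst partial_mult) auto

lemma partial_sum:
  fixes f :: "'i \<Rightarrow> real^'d::finite \<Rightarrow> real"
  assumes "\<And>i. i \<in> I \<Longrightarrow> f i differentiable at x"
  shows "partial k (\<lambda>y. \<Sum>i\<in>I. f i y) x = (\<Sum>i\<in>I. partial k (f i) x)"
proof (cases "finite I")
  case True
  have "((\<lambda>y. \<Sum>i\<in>I. f i y) has_derivative (\<lambda>h. \<Sum>i\<in>I. frechet_derivative (f i) (at x) h)) (at x)"
    using assms by (intro has_derivative_sum) (auto simp: frechet_derivative_works)
  from partial_eq[OF this] show ?thesis by (simp add: partial_def)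
qed simp

lemma has_derivative_partials:
  fixes g :: "real^'d::finite \<Rightarrow> real"
  assumes "g differentiable at x"
  shows "(g has_derivative (\<lambda>h. \<Sum>k\<in>UNIV. h $ k * partial k g x)) (at x)"
proof -
  let ?D = "frechet_derivative g (at x)"
  have D: "(g has_derivative ?D) (at x)"
    using assms frechet_derivative_works by blast
  then have lin: "linear ?D"
    by (rule has_derivative_linear)
  have "?D h = (\<Sum>k\<in>UNIV. h $ k * partial k g x)" for h
  proof -
    have "?D h = ?D (\<Sum>k\<in>UNIV. (h $ k) *\<^sub>R axis k 1)"
      by (subst basis_expansion[symmetric, of h]) (simp add: scalar_mult_eq_scaleR)
    then show ?thesis
      by (simp add: linear_sum[OF lin] linear_scale[OF lin] partial_def)
  qed
  then have "?D = (\<lambda>h. \<Sum>k\<in>UNIV. h $ k * partial k g x)" by (rule ext)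
  with D show ?thesis by simp
qed

lemma constant_if_grad_zero:
  fixes g :: "real^'d::finite \<Rightarrow> real"
  assumes "g differentiable_on UNIV" and "\<And>x. grad g x = 0"
  shows "\<exists>c. \<forall>x. g x = c"
proof -
  have "(g has_derivative (\<lambda>h. 0)) (at x)" for x
    using has_derivative_partials[of g x] assms
    by (simp add: grad_def vec_eq_iff differentiable_on_def)
  then show ?thesis
    using has_derivative_zero_constant[of UNIV g] by auto
qed

lemma differentiable_on_imp_at: "f differentiable_on UNIV \<Longrightarrow> f differentiable at x"
  by (simp add: differentiable_on_def)

lemma C_k_differentiable: "C_k (Suc m) g \<Longrightarrow> g differentiable at x"
  by (simp add: differentiable_on_imp_at)

text \<open>
  \<open>C_k (Suc m) g\<close> itself only asks for differentiability of \<open>g\<close>, from which continuity follows.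
\<close>

lemma C_k_Suc_imp: "C_k (Suc m) g \<Longrightarrow> C_k m g"
  by (induction m arbitrary: g) (auto simp: differentiable_imp_continuous_on)

lemma C_k_const [simp]: "C_k m (\<lambda>x::real^'d::finite. c)"
proof (induction m arbitrary: c)
  case (Suc m)
  have "partial k (\<lambda>x::real^'d. c) = (\<lambda>x. 0)" for k by (rule ext) simp
  with Suc[of 0] show ?case unfolding C_k.simps by (auto simp only: differentiable_on_const)
qed (simp only: C_k.simps continuous_on_const)

lemma C_k_add: "C_k m f \<Longrightarrow> C_k m g \<Longrightarrow> C_k m (\<lambda>x. f x + g x)"
proof (induction m arbitrary: f g)
  case (Suc m)
  have "partial k (\<lambda>x. f x + g x) = (\<lambda>x. partial k f x + partial k g x)" for k
    using Suc.prems by (intro ext partial_add) (auto intro: differentiable_on_imp_at)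
  then show ?case using Suc by (auto intro: derivative_intros)
qed (auto intro: continuous_intros)

lemma C_k_mult: "C_k m f \<Longrightarrow> C_k m g \<Longrightarrow> C_k m (\<lambda>x. f x * g x)"
proof (induction m arbitrary: f g)
  case (Suc m)
  have "partial k (\<lambda>x. f x * g x) = (\<lambda>x. f x * partial k g x + partial k f x * g x)" for k
    using Suc.prems by (intro ext partial_mult) (auto intro: differentiable_on_imp_at)
  moreover have "C_k m (\<lambda>x. f x * partial k g x + partial k f x * g x)" for k
    using Suc.prems C_k_Suc_imp[OF Suc.prems(1)] C_k_Suc_imp[OF Suc.prems(2)]
    by (intro C_k_add Suc.IH) auto
  ultimately show ?case using Suc.prems by (auto intro: derivative_intros)
qed (auto intro: continuous_intros)

lemma C_k_scale: "C_k m f \<Longrightarrow> C_k m (\<lambda>x. c * f x)"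
  by (intro C_k_mult) auto

lemma C_k_sum: "(\<And>i. i \<in> I \<Longrightarrow> C_k m (f i)) \<Longrightarrow> C_k m (\<lambda>x. \<Sum>i\<in>I. f i x)"
  by (induction I rule: infinite_finite_induct) (auto intro: C_k_add)

text \<open>Vector fields all of whose components have continuous partial derivatives up to order \<open>m\<close>.\<close>

definition C_k_vector :: "nat \<Rightarrow> (real^'d::finite \<Rightarrow> real^'d) \<Rightarrow> bool" where
  "C_k_vector m F \<longleftrightarrow> (\<forall>k. C_k m (\<lambda>x. F x $ k))"

lemma C_k_vector_scaleR: "C_k_vector m F \<Longrightarrow> C_k_vector m (\<lambda>x. c *\<^sub>R F x)"
  by (auto simp: C_k_vector_def intro: C_k_scale)

lemma C_k_vector_diff:
  assumes "C_k_vector m F" "C_k_vector m G"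
  shows "C_k_vector m (\<lambda>x. F x - G x)"
proof -
  have "C_k m (\<lambda>x. F x $ k + (- 1) * G x $ k)" for k
    using assms by (intro C_k_add C_k_scale) (auto simp: C_k_vector_def)
  then show ?thesis by (simp add: C_k_vector_def)
qed

lemma C_k_vector_sum:
  "(\<And>i. i \<in> I \<Longrightarrow> C_k_vector m (F i)) \<Longrightarrow> C_k_vector m (\<lambda>x. \<Sum>i\<in>I. F i x)"
  by (auto simp: C_k_vector_def intro: C_k_sum)

lemma C_k_vector_grad: "C_k (Suc m) g \<Longrightarrow> C_k_vector m (grad g)"
  by (auto simp: C_k_vector_def grad_def)

lemma divergence_add:
  assumes "C_k_vector (Suc m) F" "C_k_vector (Suc m) G"
  shows "divergence (\<lambda>y. F y + G y) x = divergence F x + divergence G x"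
  using assms unfolding divergence_def C_k_vector_def
  by (simp add: partial_add differentiable_on_imp_at sum.distrib)

lemma divergence_scaleR:
  assumes "C_k_vector (Suc m) F"
  shows "divergence (\<lambda>y. c *\<^sub>R F y) x = c * divergence F x"
  using assms unfolding divergence_def C_k_vector_def
  by (simp add: partial_scale differentiable_on_imp_at sum_distrib_left)

lemma divergence_diff:
  assumes "C_k_vector (Suc m) F" "C_k_vector (Suc m) G"
  shows "divergence (\<lambda>y. F y - G y) x = divergence F x - divergence G x"
  using divergence_add[OF assms(1) C_k_vector_scaleR[OF assms(2), of "-1"], of x]
    divergence_scaleR[OF assms(2), of "-1" x]
  by simp

lemma divergence_sum:
  assumes "\<And>i. i \<in> I \<Longrightarrow> C_k_vector (Suc m) (F i)"
  shows "divergence (\<lambda>y. \<Sum>i\<in>I. F i y) x = (\<Sum>i\<in>I. divergence (F i) x)"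
proof -
  have "divergence (\<lambda>y. \<Sum>i\<in>I. F i y) x = (\<Sum>k\<in>UNIV. \<Sum>i\<in>I. partial k (\<lambda>y. F i y $ k) x)"
    using assms unfolding divergence_def C_k_vector_def
    by (simp add: partial_sum differentiable_on_imp_at)
  also have "\<dots> = (\<Sum>i\<in>I. divergence (F i) x)"
    unfolding divergence_def by (rule sum.swap)
  finally show ?thesis .
qed

section \<open>Integrals over a period cell\<close>

text \<open>
  The translated cell loses a slab at one face and gains, at the opposite face, the copy of that
  slab translated by one period.
\<close>

lemma integral_translate_periodic:
  fixes f :: "real^'d::finite \<Rightarrow> real" and L :: "real^'d"
  assumes cont: "continuous_on UNIV f" and per: "periodic L f"
    and L: "\<And>k. L $ k > 0" and t: "0 \<le> t" "t \<le> L $ k"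
  shows "integral (cbox 0 L) (\<lambda>x. f (x + t *\<^sub>R axis k 1)) = integral (cbox 0 L) f"
proof -
  define e where "e = (axis k 1 :: real^'d)"
  define S where "S = (\<chi> m. if m = k then t else L $ m)"
  have e: "e \<in> Basis" and xe: "x \<bullet> e = x $ k" for x
    by (auto simp: e_def axis_in_Basis_iff inner_axis)
  have int: "f integrable_on cbox a b" for a b
    by (rule integrable_continuous[OF continuous_on_subset[OF cont]]) simp
  have split: "integral (cbox a b) f = integral (cbox a b \<inter> {x. x $ k \<le> c}) f
      + integral (cbox a b \<inter> {x. x $ k \<ge> c}) f" for a b c
  proof -
    have "f integrable_on (cbox a b \<inter> {x. x \<bullet> e \<le> c})" "f integrable_on (cbox a b \<inter> {x. x \<bullet> e \<ge> c})"
      unfolding interval_split[OF e] by (rule int)+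
    from integral_unique[OF has_integral_split[OF this[THEN integrable_integral] e]]
    show ?thesis by (simp add: xe)
  qed
  have cut: "cbox a b \<inter> {x. x $ k \<le> c} = cbox a (\<chi> m. if m = k then min (b $ k) c else b $ m)"
    "cbox a b \<inter> {x. x $ k \<ge> c} = cbox (\<chi> m. if m = k then max (a $ k) c else a $ m) b" for a b :: "real^'d" and c
    using interval_split_cart[where a=a and b=b and c=c and k=k] by (simp_all add: interval_cbox_cart)
  \<comment> \<open>The cell enlarged by \<open>t\<close> in direction \<open>k\<close> is cut at height \<open>t\<close> into a slab and the translated
    cell, and at height \<open>L $ k\<close> into the cell and the translated slab; \<open>cbox 0 S\<close> is the slab.\<close>
  have box1: "cbox 0 (L + t *\<^sub>R e) \<inter> {x. x $ k \<le> t} = cbox 0 S"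
    using t unfolding cut
    by (intro arg_cong2[where f=cbox]) (auto simp: vec_eq_iff S_def e_def axis_def)
  have box2: "cbox 0 (L + t *\<^sub>R e) \<inter> {x. x $ k \<ge> t} = cbox (0 + t *\<^sub>R e) (L + t *\<^sub>R e)"
    using t unfolding cut
    by (intro arg_cong2[where f=cbox]) (auto simp: vec_eq_iff S_def e_def axis_def)
  have box3: "cbox 0 (L + t *\<^sub>R e) \<inter> {x. x $ k \<le> L $ k} = cbox 0 L"
    using t unfolding cut
    by (intro arg_cong2[where f=cbox]) (auto simp: vec_eq_iff S_def e_def axis_def)
  have box4: "cbox 0 (L + t *\<^sub>R e) \<inter> {x. x $ k \<ge> L $ k} = cbox (0 + (L $ k) *\<^sub>R e) (S + (L $ k) *\<^sub>R e)"
    using t unfolding cut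
    by (intro arg_cong2[where f=cbox]) (auto simp: vec_eq_iff S_def e_def axis_def)
  have fper: "f (c + x) = f x" if "c = (L $ k) *\<^sub>R e" for c x
  proof -
    have "c = axis k (L $ k)" by (simp add: that e_def axis_def vec_eq_iff)
    then show ?thesis using per by (simp add: periodic_def add.commute)
  qed
  have "integral (cbox (0 + (L $ k) *\<^sub>R e) (S + (L $ k) *\<^sub>R e)) f = integral (cbox 0 S) f"
    by (subst integral_shift_cbox_plus[symmetric]) (simp add: o_def fper)
  moreover have "integral (cbox (0 + t *\<^sub>R e) (L + t *\<^sub>R e)) f = integral (cbox 0 L) (\<lambda>x. f (x + t *\<^sub>R e))"
    by (subst integral_shift_cbox_plus[symmetric]) (simp add: o_def add.commute)
  ultimately show ?thesis
    using split[of 0 "L + t *\<^sub>R e" t] split[of 0 "L + t *\<^sub>R e" "L $ k"]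
    unfolding box1 box2 box3 box4 unfolding e_def by linarith
qed

text \<open>
  The integral of \<open>f (x + t e\<^sub>k)\<close> over the cell does not depend on \<open>t\<close>; its derivative at \<open>t = 0\<close> is
  the integral of the partial derivative.
\<close>

lemma integral_partial_periodic:
  fixes f :: "real^'d::finite \<Rightarrow> real" and L :: "real^'d"
  assumes C1: "C_k (Suc 0) f" and per: "periodic L f" and L: "\<And>k. L $ k > 0"
  shows "integral (cbox 0 L) (partial k f) = 0"
proof -
  define e where "e = (axis k 1 :: real^'d)"
  have cont: "continuous_on UNIV f" and contp: "continuous_on UNIV (partial k f)"
    using C_k_Suc_imp[OF C1] C1 by auto
  have der: "((\<lambda>t. f (x + t *\<^sub>R e)) has_vector_derivative partial k f (x + t *\<^sub>R e)) (at t within U)"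
    for x t U
  proof -
    let ?y = "x + t *\<^sub>R e"
    have "(f has_derivative frechet_derivative f (at ?y)) (at ?y)"
      using C_k_differentiable[OF C1] frechet_derivative_works by blast
    note lin = has_derivative_linear[OF this]
    from \<open>(f has_derivative _) _\<close> have "((\<lambda>t. f (x + t *\<^sub>R e)) has_derivative
        (\<lambda>h. frechet_derivative f (at ?y) (h *\<^sub>R e))) (at t within U)"
      by (rule has_derivative_compose[where f="\<lambda>t. x + t *\<^sub>R e" and f'="\<lambda>h. h *\<^sub>R e", rotated])
        (auto intro!: derivative_eq_intros)
    moreover have "frechet_derivative f (at ?y) (h *\<^sub>R e) = h *\<^sub>R partial k f ?y" for h
      using linear_scale[OF lin, of h e] by (simp add: partial_def e_def)
    ultimately show ?thesis
      by (simp only: has_vector_derivative_def)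
  qed
  have "((\<lambda>t. integral (cbox 0 L) (\<lambda>x. f (x + t *\<^sub>R e))) has_vector_derivative
      integral (cbox 0 L) (\<lambda>x. partial k f (x + 0 *\<^sub>R e))) (at 0 within cbox 0 (L $ k))"
  proof (rule leibniz_rule_vector_derivative)
    show "continuous_on (cbox 0 (L $ k) \<times> cbox 0 L) (\<lambda>(t, x). partial k f (x + t *\<^sub>R e))"
      unfolding split_beta by (rule continuous_on_compose2[OF contp]) (auto intro!: continuous_intros)
    show "(\<lambda>x. f (x + t *\<^sub>R e)) integrable_on cbox 0 L" for t
      by (intro integrable_continuous continuous_on_compose2[OF cont]) (auto intro!: continuous_intros)
    show "0 \<in> cbox 0 (L $ k)"
      using L[of k] by simp
  qed (rule der convex_box)+
  moreover have "((\<lambda>t. integral (cbox 0 L) (\<lambda>x. f (x + t *\<^sub>R e))) has_vector_derivative 0)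
      (at 0 within cbox 0 (L $ k))"
  proof (rule has_vector_derivative_transform[OF _ _ has_vector_derivative_const])
    show "0 \<in> cbox 0 (L $ k)"
      using L[of k] by simp
    show "integral (cbox 0 L) (\<lambda>x. f (x + t *\<^sub>R e)) = integral (cbox 0 L) f"
      if "t \<in> cbox 0 (L $ k)" for t
      using that unfolding e_def by (intro integral_translate_periodic[OF cont per L]) auto
  qed
  ultimately have "integral (cbox 0 L) (\<lambda>x. partial k f (x + 0 *\<^sub>R e)) = 0"
    using L[of k] by (intro vector_derivative_unique_within_closed_interval[of 0 "L $ k" 0]) auto
  then show ?thesis by simp
qed

lemma constant_divergence_periodic:
  fixes F :: "real^'d::finite \<Rightarrow> real^'d" and L :: "real^'d"
  assumes C1: "C_k_vector (Suc 0) F" and per: "periodic L F" and L: "\<And>k. L $ k > 0"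
    and c: "\<And>x. divergence F x = c"
  shows "c = 0"
proof -
  have int0: "(partial k (\<lambda>y. F y $ k) has_integral 0) (cbox 0 L)" for k
  proof -
    have C: "C_k (Suc 0) (\<lambda>y. F y $ k)" using C1 by (simp add: C_k_vector_def)
    then have "continuous_on UNIV (partial k (\<lambda>y. F y $ k))" by simp
    from integrable_continuous[OF continuous_on_subset[OF this]]
    have "partial k (\<lambda>y. F y $ k) integrable_on cbox 0 L" by simp
    moreover have perk: "periodic L (\<lambda>y. F y $ k)" using per by (simp add: periodic_def)
    ultimately show ?thesis
      using integral_partial_periodic[OF C perk L, of k] by (simp add: has_integral_integrable_integral)
  qed
  have "(divergence F has_integral (\<Sum>k\<in>(UNIV::'d set). 0)) (cbox 0 L)"
    unfolding divergence_def by (intro has_integral_sum int0) auto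
  moreover have "divergence F = (\<lambda>x. c)" using c by auto
  ultimately have "((\<lambda>x. c) has_integral 0) (cbox 0 L)" by simp
  then have "measure lborel (cbox 0 L) *\<^sub>R c = 0"
    by (rule has_integral_unique[OF has_integral_const])
  moreover have "measure lborel (cbox 0 L) > 0"
    unfolding content_pos_lt_eq using L by (auto simp: Basis_vec_def inner_axis)
  ultimately show ?thesis by simp
qed

section \<open>Coefficients of formal expansions\<close>

lemma regular_scalar_iff: "regular_scalar f \<longleftrightarrow> (\<forall>m. C_k 2 (\<lambda>x. fps_nth (f x) m))"
proof -
  have "scoeff m f = (\<lambda>x. fps_nth (f x) m)" for m by (rule ext) (simp add: scoeff_def)
  then show ?thesis by (simp add: regular_scalar_def)
qed

lemma regular_vector_iff: "regular_vector F \<longleftrightarrow> (\<forall>k. regular_scalar (\<lambda>x. F x $ k))"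
  by (auto simp: regular_vector_def regular_scalar_iff vcoeff_def)

lemma regular_scalar_const: "regular_scalar (\<lambda>x::real^'d::finite. a)"
  by (auto simp: regular_scalar_iff)

lemma regular_scalar_diff:
  assumes "regular_scalar f" "regular_scalar g"
  shows "regular_scalar (\<lambda>x. f x - g x)"
  unfolding regular_scalar_iff
proof
  fix m
  have "C_k 2 (\<lambda>x. fps_nth (f x) m + (- 1) * fps_nth (g x) m)"
    using assms unfolding regular_scalar_iff by (intro C_k_add C_k_scale) auto
  then show "C_k 2 (\<lambda>x. fps_nth (f x - g x) m)" by simp
qed

lemma regular_scalar_mult:
  assumes "regular_scalar f" "regular_scalar g"
  shows "regular_scalar (\<lambda>x. f x * g x)"
  using assms unfolding regular_scalar_iff fps_mult_nth
  by (auto intro!: C_k_sum C_k_mult)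

lemma regular_scalar_power:
  assumes "regular_scalar f"
  shows "regular_scalar (\<lambda>x. f x ^ n)"
  by (induction n) (auto intro: regular_scalar_const regular_scalar_mult assms)

lemma regular_scalar_compose:
  assumes "regular_scalar f"
  shows "regular_scalar (\<lambda>x. fps_compose a (f x))"
  using regular_scalar_power[OF assms]
  unfolding regular_scalar_iff fps_compose_nth
  by (auto intro!: C_k_sum C_k_scale)

text \<open>
  The coefficients of the pressure are polynomials in those of the density with coefficients
  depending on the leading density.  For a constant leading density these coefficients are
  constants.
\<close>

lemma regular_scalar_pressure:
  assumes "regular_scalar r" and "\<And>x. scoeff 0 r x = c"
  shows "regular_scalar (\<lambda>x. pressure \<kappa> \<gamma> (r x))"
  using assms(2) unfolding pressure_def scoeff_def
  by (simp only:) (intro regular_scalar_mult regular_scalar_compose regular_scalar_diff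
      regular_scalar_const assms(1))

lemma pressure_nth_1:
  assumes "fps_nth r 0 \<noteq> 0"
  shows "fps_nth (pressure \<kappa> \<gamma> r) 1 = \<kappa> * fps_nth r 0 powr \<gamma> * \<gamma> / fps_nth r 0 * fps_nth r 1"
proof -
  have "{0..1::nat} = {0, 1}" by auto
  then show ?thesis
    by (simp add: pressure_def fps_compose_nth fps_mult_left_const_nth field_simps)
qed

lemma regular_momentum:
  assumes "regular_scalar r" "regular_vector u"
  shows "regular_vector (\<lambda>x. r x *s u x)"
  using assms by (auto simp: regular_vector_iff intro: regular_scalar_mult)

lemma C_k_scoeff: "regular_scalar f \<Longrightarrow> C_k (Suc (Suc 0)) (scoeff m f)"
  unfolding numeral_2_eq_2[symmetric] by (simp add: regular_scalar_def)

lemma C_k_vector_vcoeff: "regular_vector F \<Longrightarrow> C_k_vector (Suc (Suc 0)) (vcoeff m F)"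
  unfolding numeral_2_eq_2[symmetric] by (simp add: regular_vector_def C_k_vector_def)

lemma C_k_vector_Suc_imp: "C_k_vector (Suc m) F \<Longrightarrow> C_k_vector m F"
  unfolding C_k_vector_def using C_k_Suc_imp by blast

lemma vcoeff_ftdiv: "vcoeff m (ftdiv T) = tensor_divergence (tcoeff m T)"
  by (rule ext) (simp add: vcoeff_def ftdiv_def vec_eq_iff)

lemma vcoeff_fgrad: "vcoeff m (fgrad f) = grad (scoeff m f)"
  by (rule ext) (simp add: vcoeff_def fgrad_def vec_eq_iff)

lemma C_k_vector_convection:
  assumes "regular_vector F" "regular_vector G"
  shows "C_k_vector (Suc 0) (vcoeff m (ftdiv (\<lambda>y. F y \<otimes>\<^sub>v G y)))"
proof -
  have "C_k 2 (\<lambda>y. fps_nth (F y $ l * G y $ k) m)" for k l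
    using assms regular_scalar_mult unfolding regular_vector_iff
    by (fastforce simp: regular_scalar_iff)
  then have "C_k 1 (partial l (\<lambda>y. fps_nth (F y $ l * G y $ k) m))" for k l
    by (simp add: numeral_2_eq_2)
  then show ?thesis
    unfolding vcoeff_ftdiv C_k_vector_def tensor_divergence_def divergence_def tcoeff_def outer_def
    by (auto intro!: C_k_sum simp del: C_k.simps)
qed

lemma vcoeff_0_mult: "vcoeff 0 (\<lambda>y. r y *s u y) x = scoeff 0 r x *\<^sub>R vcoeff 0 u x"
  by (simp add: vcoeff_def scoeff_def vec_eq_iff)

lemma tcoeff_0_outer: "tcoeff 0 (\<lambda>y. F y \<otimes>\<^sub>v G y) x = vcoeff 0 F x \<otimes>\<^sub>v vcoeff 0 G x"
  by (simp add: vcoeff_def tcoeff_def vec_eq_iff outer_def)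

lemma tensor_divergence_scaleR:
  fixes T :: "real^'d::finite \<Rightarrow> real^'d^'d"
  assumes "\<And>l k. C_k (Suc m) (\<lambda>y. T y $ l $ k)"
  shows "tensor_divergence (\<lambda>y. c *\<^sub>R T y) x = c *\<^sub>R tensor_divergence T x"
  using divergence_scaleR[of m "\<lambda>y. \<chi> l. T y $ l $ k" c x for k] assms
  by (simp add: tensor_divergence_def vec_eq_iff C_k_vector_def scaleR_vec_def)

text \<open>
  Balancing powers of \<open>\<epsilon>\<close>: the factor \<open>\<epsilon>\<^sup>-\<^sup>2\<close> shifts the index of the pressure by two, so order
  \<open>m \<ge> 0\<close> involves \<open>p\<^sub>m\<^sub>+\<^sub>2\<close>, and the orders \<open>-2\<close> and \<open>-1\<close> involve \<open>p\<^sub>0\<close> and \<open>p\<^sub>1\<close> alone.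
\<close>

lemma momentum_stage_coeff:
  assumes "momentum_stage At A \<kappa> \<gamma> h rn un r u i"
  shows "vcoeff m (\<lambda>y. r i y *s u i y) x =
    vcoeff m (\<lambda>y. rn y *s un y) x
    - h *\<^sub>R (\<Sum>j=1..<i. At i j *\<^sub>R vcoeff m (ftdiv (\<lambda>y. (r j y *s u j y) \<otimes>\<^sub>v u j y)) x)
    - h *\<^sub>R (\<Sum>j=1..i. A i j *\<^sub>R grad (scoeff (m + 2) (\<lambda>y. pressure \<kappa> \<gamma> (r j y))) x)"
  (is "?l = ?r")
proof -
  have "?l $ k = ?r $ k" for k
    using arg_cong[OF assms[unfolded momentum_stage_def, rule_format, of x k],
        where f = "\<lambda>f. fls_nth f (int m)"]
    by (simp add: fls_shifted_times_simps fls_nth_sum vcoeff_def fgrad_def nat_add_distrib)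
  then show ?thesis by (simp add: vec_eq_iff)
qed

lemma momentum_stage_singular:
  assumes "momentum_stage At A \<kappa> \<gamma> h rn un r u i" and "h \<noteq> 0" and "m < 2"
  shows "(\<Sum>j=1..i. A i j *\<^sub>R grad (scoeff m (\<lambda>y. pressure \<kappa> \<gamma> (r j y))) x) = 0" (is "?l = 0")
proof -
  have "?l $ k = 0" for k
    using arg_cong[OF assms(1)[unfolded momentum_stage_def, rule_format, of x k],
        where f = "\<lambda>f. fls_nth f (int m - 2)"] assms(2,3)
    by (simp add: fls_shifted_times_simps fls_nth_sum fgrad_def)
  then show ?thesis by (simp add: vec_eq_iff)
qed

lemma density_stage_coeff:
  assumes "density_stage At A \<kappa> \<gamma> h rn un r u i"
  shows "scoeff m (r i) x = scoeff m rn x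
    - h * (\<Sum>j=1..<i. A i j * divergence (vcoeff m (\<lambda>y. r j y *s u j y)) x)
    - h * A i i * divergence (vcoeff m (\<lambda>y. rn y *s un y)) x
    + h\<^sup>2 * A i i * (\<Sum>j=1..<i. At i j *
        divergence (vcoeff m (ftdiv (\<lambda>y. (r j y *s u j y) \<otimes>\<^sub>v u j y))) x)
    + h\<^sup>2 * A i i * (\<Sum>j=1..i. A i j *
        divergence (grad (scoeff (m + 2) (\<lambda>y. pressure \<kappa> \<gamma> (r j y)))) x)"
  using arg_cong[OF assms[unfolded density_stage_def, rule_format, of x],
      where f = "\<lambda>f. fls_nth f (int m)"]
  by (simp add: fls_shifted_times_simps fls_nth_sum fdiv_def flaplacian_def vcoeff_fgrad
      scoeff_def[of m] nat_add_distrib mult.assoc)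

section \<open>One time step\<close>

lemma lower_triangular_solve_zero:
  fixes X :: "nat \<Rightarrow> 'v::real_vector"
  assumes "\<And>i. i \<in> {1..s} \<Longrightarrow> A i i \<noteq> 0"
    and "\<And>i. i \<in> {1..s} \<Longrightarrow> (\<Sum>j=1..i. A i j *\<^sub>R X j) = 0"
    and "i \<in> {1..s}"
  shows "X i = 0"
  using assms(3)
proof (induction i rule: less_induct)
  case (less i)
  have "(\<Sum>j=1..i. A i j *\<^sub>R X j) = (\<Sum>j=1..<i. A i j *\<^sub>R X j) + A i i *\<^sub>R X i"
    using less.prems by (simp add: atLeastLessThanSuc_atLeastAtMost[symmetric])
  moreover have "(\<Sum>j=1..<i. A i j *\<^sub>R X j) = 0"
    using less by (intro sum.neutral) auto
  ultimately show ?case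
    using assms(1,2)[OF less.prems] by simp
qed

text \<open>
  One step of size \<open>h\<close> of the scheme for formal expansions, from the data \<open>rn, un\<close> with stages
  \<open>r i, u i\<close>.  Of the Runge--Kutta structure only the non-zero implicit diagonal is needed here, since
  the sums in the stage equations already express the triangular shape.
\<close>

locale formal_step =
  fixes s :: nat and At A :: "nat \<Rightarrow> nat \<Rightarrow> real" and \<kappa> \<gamma> h :: real and L :: "real^'d::finite"
    and rn :: "real^'d \<Rightarrow> real fps" and un :: "real^'d \<Rightarrow> (real fps)^'d"
    and r :: "nat \<Rightarrow> real^'d \<Rightarrow> real fps" and u :: "nat \<Rightarrow> real^'d \<Rightarrow> (real fps)^'d"
  assumes kappa_pos: "\<kappa> > 0" and gamma_pos: "\<gamma> > 0" and h_pos: "h > 0"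
    and diag: "\<And>i. i \<in> {1..s} \<Longrightarrow> A i i \<noteq> 0"
    and L_pos: "\<And>k. L $ k > 0"
    and r_periodic: "\<And>i. i \<in> {1..s} \<Longrightarrow> periodic L (r i)"
    and u_periodic: "\<And>i. i \<in> {1..s} \<Longrightarrow> periodic L (u i)"
    and rn_regular: "regular_scalar rn" and un_regular: "regular_vector un"
    and r_regular: "\<And>i. i \<in> {1..s} \<Longrightarrow> regular_scalar (r i)"
    and u_regular: "\<And>i. i \<in> {1..s} \<Longrightarrow> regular_vector (u i)"
    and r_pos: "\<And>i x. i \<in> {1..s} \<Longrightarrow> scoeff 0 (r i) x > 0"
    and density: "\<And>i. i \<in> {1..s} \<Longrightarrow> density_stage At A \<kappa> \<gamma> h rn un r u i"
    and momentum: "\<And>i. i \<in> {1..s} \<Longrightarrow> momentum_stage At A \<kappa> \<gamma> h rn un r u i"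
begin

text \<open>Expansions of the stage pressures and of the stage momenta.\<close>

abbreviation p :: "nat \<Rightarrow> real^'d \<Rightarrow> real fps" where
  "p j \<equiv> \<lambda>y. pressure \<kappa> \<gamma> (r j y)"

abbreviation mom :: "nat \<Rightarrow> real^'d \<Rightarrow> (real fps)^'d" where
  "mom j \<equiv> \<lambda>y. r j y *s u j y"

lemma grad_pressure_zero:
  assumes "i \<in> {1..s}" and "m < 2"
  shows "grad (scoeff m (p i)) x = 0"
  by (rule lower_triangular_solve_zero[where A = A and X = "\<lambda>i. grad (scoeff m (p i)) x", OF diag _ assms(1)])
    (use momentum_stage_singular[OF momentum] h_pos assms(2) in auto)

lemma leading_density_constant:
  assumes i: "i \<in> {1..s}"
  shows "\<exists>c. \<forall>x. scoeff 0 (r i) x = c"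
proof -
  have p0: "scoeff 0 (p i) = (\<lambda>x. \<kappa> * scoeff 0 (r i) x powr \<gamma>)"
    by (rule ext) (simp add: scoeff_def pressure_nth_0)
  note C2 = C_k_scoeff[OF r_regular[OF i], of 0]
  have "scoeff 0 (p i) differentiable at x" for x
  proof -
    have "(scoeff 0 (r i) has_derivative frechet_derivative (scoeff 0 (r i)) (at x)) (at x)"
      using C_k_differentiable[OF C2] frechet_derivative_works by blast
    from has_derivative_powr[OF this has_derivative_const[of \<gamma>] r_pos[OF i]]
    have "(\<lambda>x. scoeff 0 (r i) x powr \<gamma>) differentiable at x"
      by (auto intro: differentiableI)
    then show ?thesis unfolding p0 by (intro derivative_intros)
  qed
  then obtain c where c: "scoeff 0 (p i) x = c" for x
    using constant_if_grad_zero[of "scoeff 0 (p i)"] grad_pressure_zero[OF i, of 0]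
    by (auto simp: differentiable_on_def)
  have "scoeff 0 (r i) x = (c / \<kappa>) powr (1 / \<gamma>)" for x
  proof -
    have "scoeff 0 (r i) x powr \<gamma> = c / \<kappa>"
      using c[of x] kappa_pos unfolding p0 by (simp add: field_simps)
    \<comment> \<open>The power is inverted using \<open>\<gamma> \<noteq> 0\<close> and positivity of the density.\<close>
    then show ?thesis
      using r_pos[OF i, of x] gamma_pos
      by (metis abs_of_pos less_irrefl powr_one' powr_powr nonzero_divide_eq_eq mult.commute)
  qed
  then show ?thesis by blast
qed

lemma pressure_regular:
  assumes "i \<in> {1..s}"
  shows "regular_scalar (p i)"
  using leading_density_constant[OF assms] regular_scalar_pressure[OF r_regular[OF assms]] by blast

lemma first_order_density_constant:
  assumes i: "i \<in> {1..s}"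
  shows "\<exists>c. \<forall>x. scoeff 1 (r i) x = c"
proof -
  obtain c0 where c0: "scoeff 0 (r i) x = c0" for x
    using leading_density_constant[OF i] by blast
  have pos: "c0 > 0" using r_pos[OF i] c0 by simp
  obtain c where c: "scoeff 1 (p i) x = c" for x
    using constant_if_grad_zero[of "scoeff 1 (p i)"] grad_pressure_zero[OF i, of 1]
      C_k_scoeff[OF pressure_regular[OF i], of 1] by auto
  define K where "K = \<kappa> * c0 powr \<gamma> * \<gamma> / c0"
  have K: "K \<noteq> 0" using kappa_pos gamma_pos pos by (simp add: K_def)
  have "K * scoeff 1 (r i) x = c" for x
    using c[of x] c0[of x] pos pressure_nth_1[of "r i x" \<kappa> \<gamma>] by (simp add: scoeff_def K_def)
  then have "scoeff 1 (r i) x = c / K" for x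
    using K by (simp add: field_simps)
  then show ?thesis by blast
qed

lemma momentum_regular: "i \<in> {1..s} \<Longrightarrow> C_k_vector (Suc 0) (vcoeff m (mom i))"
  by (rule C_k_vector_Suc_imp, intro C_k_vector_vcoeff regular_momentum r_regular u_regular)

text \<open>
  The momentum stage inserted into the density stage: the scheme is the IMEX discretisation of the
  continuity equation with the mass flux treated implicitly.
\<close>

lemma mass_balance:
  assumes i: "i \<in> {1..s}"
  shows "scoeff m (r i) x = scoeff m rn x - h * (\<Sum>j=1..i. A i j * divergence (vcoeff m (mom j)) x)"
proof -
  define F where "F = vcoeff m (\<lambda>y. rn y *s un y)"
  define T where "T j = vcoeff m (ftdiv (\<lambda>y. mom j y \<otimes>\<^sub>v u j y))" for j
  define G where "G j = grad (scoeff (m + 2) (p j))" for j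
  have F: "C_k_vector (Suc 0) F"
    unfolding F_def
    by (rule C_k_vector_Suc_imp, intro C_k_vector_vcoeff regular_momentum rn_regular un_regular)
  have T: "C_k_vector (Suc 0) (T j)" if "j \<in> {1..s}" for j
    unfolding T_def
    by (intro C_k_vector_convection regular_momentum r_regular u_regular that)
  have G: "C_k_vector (Suc 0) (G j)" if "j \<in> {1..s}" for j
    unfolding G_def by (intro C_k_vector_grad C_k_scoeff pressure_regular that)
  have sT: "C_k_vector (Suc 0) (\<lambda>y. h *\<^sub>R (\<Sum>j=1..<i. At i j *\<^sub>R T j y))"
    and sG: "C_k_vector (Suc 0) (\<lambda>y. h *\<^sub>R (\<Sum>j=1..i. A i j *\<^sub>R G j y))"
    and sT': "C_k_vector (Suc 0) (\<lambda>y. \<Sum>j=1..<i. At i j *\<^sub>R T j y)"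
    and sG': "C_k_vector (Suc 0) (\<lambda>y. \<Sum>j=1..i. A i j *\<^sub>R G j y)"
    using i by (auto intro!: C_k_vector_scaleR C_k_vector_sum T G)
  have FsT: "C_k_vector (Suc 0) (\<lambda>y. F y - h *\<^sub>R (\<Sum>j=1..<i. At i j *\<^sub>R T j y))"
    by (rule C_k_vector_diff[OF F sT])
  have dT: "divergence (\<lambda>y. \<Sum>j=1..<i. At i j *\<^sub>R T j y) x = (\<Sum>j=1..<i. At i j * divergence (T j) x)"
    using i by (subst divergence_sum[of _ 0]) (auto intro!: sum.cong divergence_scaleR C_k_vector_scaleR T)
  have dG: "divergence (\<lambda>y. \<Sum>j=1..i. A i j *\<^sub>R G j y) x = (\<Sum>j=1..i. A i j * divergence (G j) x)"
    using i by (subst divergence_sum[of _ 0]) (auto intro!: sum.cong divergence_scaleR C_k_vector_scaleR G)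
  have "vcoeff m (mom i) = (\<lambda>y. F y - h *\<^sub>R (\<Sum>j=1..<i. At i j *\<^sub>R T j y)
      - h *\<^sub>R (\<Sum>j=1..i. A i j *\<^sub>R G j y))"
    unfolding F_def T_def G_def by (rule ext) (rule momentum_stage_coeff[OF momentum[OF i]])
  then have div_mom: "divergence (vcoeff m (mom i)) x = divergence F x
      - h * (\<Sum>j=1..<i. At i j * divergence (T j) x) - h * (\<Sum>j=1..i. A i j * divergence (G j) x)"
    by (simp only: divergence_diff[OF FsT sG] divergence_diff[OF F sT]
        divergence_scaleR[OF sT'] divergence_scaleR[OF sG'] dT dG)
  have split: "(\<Sum>j=1..i. A i j * divergence (vcoeff m (mom j)) x)
      = (\<Sum>j=1..<i. A i j * divergence (vcoeff m (mom j)) x) + A i i * divergence (vcoeff m (mom i)) x"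
    using i by (simp add: atLeastLessThanSuc_atLeastAtMost[symmetric])
  show ?thesis
    using density_stage_coeff[OF density[OF i], of m x, folded F_def T_def G_def]
    unfolding split div_mom by (simp add: algebra_simps power2_eq_square)
qed

lemma momentum_periodic:
  assumes "i \<in> {1..s}"
  shows "periodic L (vcoeff m (mom i))"
  using r_periodic[OF assms] u_periodic[OF assms] by (simp add: periodic_def vcoeff_def)

text \<open>
  By the mass balance the difference of the two constants is a multiple of the divergence of a
  periodic field.
\<close>

lemma constant_density_conserved:
  assumes i: "i \<in> {1..s}" and c: "\<And>x. scoeff m (r i) x = c" and c': "\<And>x. scoeff m rn x = c'"
  shows "c = c'"
proof -
  define M where "M = (\<lambda>y. \<Sum>j=1..i. A i j *\<^sub>R vcoeff m (mom j) y)"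
  have reg: "C_k_vector (Suc 0) (vcoeff m (mom j))" if "j \<in> {1..i}" for j
    using momentum_regular[of j m] that i by simp
  have "divergence M x = (\<Sum>j=1..i. A i j * divergence (vcoeff m (mom j)) x)" for x
    unfolding M_def
    by (subst divergence_sum[of _ 0]) (auto intro!: sum.cong divergence_scaleR C_k_vector_scaleR reg)
  then have "divergence M x = (c' - c) / h" for x
    using mass_balance[OF i, of m x] c c' h_pos by (simp add: field_simps)
  moreover have "C_k_vector (Suc 0) M"
    unfolding M_def by (intro C_k_vector_sum C_k_vector_scaleR reg)
  moreover have "periodic L M"
  proof -
    have "vcoeff m (mom j) (x + axis k (L $ k)) = vcoeff m (mom j) x" if "j \<in> {1..i}" for j x k
      using momentum_periodic[of j m] that i by (simp add: periodic_def)
    then show ?thesis by (simp add: periodic_def M_def)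
  qed
  ultimately have "(c' - c) / h = 0"
    using constant_divergence_periodic[OF _ _ L_pos] by blast
  then show ?thesis using h_pos by simp
qed

text \<open>
  Consequences of well-prepared data at time level \<open>n\<close>: leading density \<open>C\<close>, no term of first order.
  The mass balance contains the fluxes of the stages only, so the leading velocity of the stages is
  divergence-free whatever its divergence at time level \<open>n\<close>.
\<close>

context
  fixes C :: real
  assumes rn_0: "\<And>x. scoeff 0 rn x = C" and rn_1: "\<And>x. scoeff 1 rn x = 0"
begin

lemma leading_density:
  assumes "i \<in> {1..s}"
  shows "scoeff 0 (r i) x = C"
  using leading_density_constant[OF assms] constant_density_conserved[OF assms _ rn_0] by blast

lemma first_order_density:
  assumes "i \<in> {1..s}"
  shows "scoeff 1 (r i) x = 0"
  using first_order_density_constant[OF assms] constant_density_conserved[OF assms _ rn_1] by blast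

lemma leading_momentum:
  assumes "i \<in> {1..s}"
  shows "vcoeff 0 (mom i) = (\<lambda>y. C *\<^sub>R vcoeff 0 (u i) y)"
  by (rule ext) (simp add: vcoeff_0_mult leading_density[OF assms])

lemma leading_velocity_C2:
  assumes "i \<in> {1..s}"
  shows "C_k_vector (Suc (Suc 0)) (vcoeff 0 (u i))"
  by (rule C_k_vector_vcoeff[OF u_regular[OF assms]])

lemma density_constant_pos: "1 \<le> s \<Longrightarrow> C > 0"
  using leading_density[of 1] r_pos[of 1] by (metis atLeastAtMost_iff order_refl)

lemma leading_velocity_div_free:
  assumes i: "i \<in> {1..s}"
  shows "divergence (vcoeff 0 (u i)) x = 0"
proof -
  have "divergence (vcoeff 0 (mom i)) x = 0"
  proof (rule lower_triangular_solve_zero[where A = A and X = "\<lambda>i. divergence (vcoeff 0 (mom i)) x",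
        OF diag _ i])
    fix i assume "i \<in> {1..s}"
    then show "(\<Sum>j=1..i. A i j *\<^sub>R divergence (vcoeff 0 (mom j)) x) = 0"
      using mass_balance[of i 0 x] h_pos by (simp add: leading_density rn_0)
  qed
  moreover have "divergence (vcoeff 0 (mom i)) x = C * divergence (vcoeff 0 (u i)) x"
    unfolding leading_momentum[OF i] by (rule divergence_scaleR[OF leading_velocity_C2[OF i]])
  ultimately show ?thesis
    using density_constant_pos i by auto
qed

lemma leading_convection:
  assumes j: "j \<in> {1..s}"
  shows "vcoeff 0 (ftdiv (\<lambda>y. mom j y \<otimes>\<^sub>v u j y)) x =
    C *\<^sub>R tensor_divergence (\<lambda>y. vcoeff 0 (u j) y \<otimes>\<^sub>v vcoeff 0 (u j) y) x"
proof -
  have "tcoeff 0 (\<lambda>y. mom j y \<otimes>\<^sub>v u j y) =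
      (\<lambda>y. C *\<^sub>R (vcoeff 0 (u j) y \<otimes>\<^sub>v vcoeff 0 (u j) y))"
    unfolding tcoeff_0_outer leading_momentum[OF j] by (simp add: outer_def vec_eq_iff fun_eq_iff mult.assoc)
  moreover have C2: "C_k (Suc (Suc 0)) (\<lambda>y. (vcoeff 0 (u j) y \<otimes>\<^sub>v vcoeff 0 (u j) y) $ l $ k)" for l k
    using leading_velocity_C2[OF j] unfolding C_k_vector_def outer_def
    by (auto intro!: C_k_mult simp del: C_k.simps)
  ultimately show ?thesis
    by (simp only: vcoeff_ftdiv tensor_divergence_scaleR[OF C2])
qed

lemma leading_momentum_balance:
  assumes i: "i \<in> {1..s}"
  shows "C *\<^sub>R vcoeff 0 (u i) x = C *\<^sub>R vcoeff 0 un x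
    - h *\<^sub>R (\<Sum>j=1..<i. At i j *\<^sub>R (C *\<^sub>R
        tensor_divergence (\<lambda>y. vcoeff 0 (u j) y \<otimes>\<^sub>v vcoeff 0 (u j) y) x))
    - h *\<^sub>R (\<Sum>j=1..i. A i j *\<^sub>R grad (scoeff 2 (p j)) x)"
proof -
  have "(\<Sum>j=1..<i. At i j *\<^sub>R vcoeff 0 (ftdiv (\<lambda>y. mom j y \<otimes>\<^sub>v u j y)) x) =
      (\<Sum>j=1..<i. At i j *\<^sub>R (C *\<^sub>R
        tensor_divergence (\<lambda>y. vcoeff 0 (u j) y \<otimes>\<^sub>v vcoeff 0 (u j) y) x))"
    using i by (intro sum.cong) (auto simp: leading_convection)
  then show ?thesis
    using momentum_stage_coeff[OF momentum[OF i], of 0 x, unfolded add_0]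
    by (simp only: leading_momentum[OF i] vcoeff_0_mult rn_0)
qed

lemma leading_velocity_balance:
  assumes i: "i \<in> {1..s}"
  shows "vcoeff 0 (u i) x = vcoeff 0 un x
    - h *\<^sub>R (\<Sum>j=1..<i. At i j *\<^sub>R
        tensor_divergence (\<lambda>y. vcoeff 0 (u j) y \<otimes>\<^sub>v vcoeff 0 (u j) y) x)
    - (h / C) *\<^sub>R (\<Sum>j=1..i. A i j *\<^sub>R grad (scoeff 2 (p j)) x)"
proof -
  have C: "C \<noteq> 0" using density_constant_pos i by auto
  have "C *\<^sub>R vcoeff 0 (u i) x = C *\<^sub>R (vcoeff 0 un x
    - h *\<^sub>R (\<Sum>j=1..<i. At i j *\<^sub>R
        tensor_divergence (\<lambda>y. vcoeff 0 (u j) y \<otimes>\<^sub>v vcoeff 0 (u j) y) x)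
    - (h / C) *\<^sub>R (\<Sum>j=1..i. A i j *\<^sub>R grad (scoeff 2 (p j)) x))"
    unfolding leading_momentum_balance[OF i]
    using C by (simp add: scaleR_diff_right scaleR_sum_right mult.left_commute mult.commute)
  then show ?thesis using C by simp
qed

end

end

section \<open>Induction over the time levels\<close>

theorem theorem1:
  fixes s :: nat and At A :: "nat \<Rightarrow> nat \<Rightarrow> real" and bt b ct c :: "nat \<Rightarrow> real"
    and \<kappa> \<gamma> :: real and t :: "nat \<Rightarrow> real" and L :: "real^'d::finite"
    and \<rho> :: "nat \<Rightarrow> real^'d \<Rightarrow> real fps" and u :: "nat \<Rightarrow> real^'d \<Rightarrow> (real fps)^'d"
    and \<rho>\<^sub>s :: "nat \<Rightarrow> nat \<Rightarrow> real^'d \<Rightarrow> real fps" and u\<^sub>s :: "nat \<Rightarrow> nat \<Rightarrow> real^'d \<Rightarrow> (real fps)^'d"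
    and r\<^sub>0 :: real and r\<^sub>2 :: "real^'d \<Rightarrow> real" and v\<^sub>0 v\<^sub>1 :: "real^'d \<Rightarrow> real^'d"
    and \<rho>\<^sub>0 :: "real fps"
  assumes "\<kappa> > 0" and "\<gamma> > 1"
    and "\<And>n. t n < t (Suc n)"
    and "imex_rk s At A ct c" and "globally_stiffly_accurate s At A bt b ct c"
    and "\<And>k. L $ k > 0"
    and "\<And>n. periodic L (\<rho> n)" and "\<And>n. periodic L (u n)"
    and "\<And>n i. i \<in> {1..s} \<Longrightarrow> periodic L (\<rho>\<^sub>s n i)"
    and "\<And>n i. i \<in> {1..s} \<Longrightarrow> periodic L (u\<^sub>s n i)"
    and "\<And>n. regular_scalar (\<rho> n)" and "\<And>n. regular_vector (u n)"
    and "\<And>n i. i \<in> {1..s} \<Longrightarrow> regular_scalar (\<rho>\<^sub>s n i)"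
    and "\<And>n i. i \<in> {1..s} \<Longrightarrow> regular_vector (u\<^sub>s n i)"
    and "\<And>n x. scoeff 0 (\<rho> n) x > 0"
    and "\<And>n i x. i \<in> {1..s} \<Longrightarrow> scoeff 0 (\<rho>\<^sub>s n i) x > 0"
    and "\<And>n i. i \<in> {1..s} \<Longrightarrow>
           density_stage At A \<kappa> \<gamma> (t (Suc n) - t n) (\<rho> n) (u n) (\<rho>\<^sub>s n) (u\<^sub>s n) i"
    and "\<And>n i. i \<in> {1..s} \<Longrightarrow>
           momentum_stage At A \<kappa> \<gamma> (t (Suc n) - t n) (\<rho> n) (u n) (\<rho>\<^sub>s n) (u\<^sub>s n) i"
    and "\<And>n. \<rho> (Suc n) = \<rho>\<^sub>s n s" and "\<And>n. u (Suc n) = u\<^sub>s n s"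
    and "\<And>x. \<rho> 0 x = fps_const r\<^sub>0 + fps_X^2 * fps_const (r\<^sub>2 x)"
    and "\<And>x. u 0 x = (\<chi> k. fps_const (v\<^sub>0 x $ k) + fps_X * fps_const (v\<^sub>1 x $ k))"
    and "\<And>x. divergence v\<^sub>0 x = 0"
    and "\<And>x. \<rho>\<^sub>0 = fps_const (scoeff 0 (\<rho> 0) x) + fps_X * fps_const (scoeff 1 (\<rho> 0) x)"
  shows "(\<forall>n. \<forall>i\<in>{1..s}.
            (\<exists>C. \<forall>x. scoeff 0 (\<rho>\<^sub>s n i) x = C) \<and>
            (\<exists>C. \<forall>x. scoeff 1 (\<rho>\<^sub>s n i) x = C) \<and>
            (\<forall>x. fps_const (scoeff 0 (\<rho>\<^sub>s n i) x) + fps_X * fps_const (scoeff 1 (\<rho>\<^sub>s n i) x) = \<rho>\<^sub>0) \<and>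
            (\<forall>x. divergence (vcoeff 0 (u\<^sub>s n i)) x = 0) \<and>
            (\<forall>x k. fps_const (vcoeff 0 (u\<^sub>s n i) x $ k) =
               fps_const (vcoeff 0 (u n) x $ k)
               - fps_const (t (Suc n) - t n) * (\<Sum>j=1..<i. fps_const (At i j) *
                   fps_const (tensor_divergence
                     (\<lambda>y. vcoeff 0 (u\<^sub>s n j) y \<otimes>\<^sub>v vcoeff 0 (u\<^sub>s n j) y) x $ k))
               - fps_const (t (Suc n) - t n) / \<rho>\<^sub>0 * (\<Sum>j=1..i. fps_const (A i j) *
                   fps_const (grad (scoeff 2 (\<lambda>y. pressure \<kappa> \<gamma> (\<rho>\<^sub>s n j y))) x $ k)))) \<and>
         (\<forall>n. imex_rk_incompressible_Euler s At A bt b (t (Suc n) - t n) r\<^sub>0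
            (scoeff 0 (\<rho> n)) (vcoeff 0 (u n))
            (\<lambda>i. scoeff 0 (\<rho>\<^sub>s n i)) (\<lambda>i. vcoeff 0 (u\<^sub>s n i))
            (\<lambda>i. scoeff 2 (\<lambda>y. pressure \<kappa> \<gamma> (\<rho>\<^sub>s n i y)))
            (scoeff 0 (\<rho> (Suc n))) (vcoeff 0 (u (Suc n))))"
proof -
  have s: "1 \<le> s" and diag: "\<And>i. i \<in> {1..s} \<Longrightarrow> A i i \<noteq> 0"
    and At0: "At s s = 0"
    using assms(4) by (auto simp: imex_rk_def)
  have b: "A s j = b j" "At s j = bt j" if "j \<in> {1..s}" for j
    using assms(5) that by (auto simp: globally_stiffly_accurate_def)
  have s_in: "s \<in> {1..s}" using s by simp
  have step: "formal_step s At A \<kappa> \<gamma> (t (Suc n) - t n) L (\<rho> n) (u n) (\<rho>\<^sub>s n) (u\<^sub>s n)" for n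
    using assms(1-3,6,9-14,16-18) diag by unfold_locales (auto simp: less_trans[of 0 1])
  have inv: "(\<forall>x. scoeff 0 (\<rho> n) x = r\<^sub>0) \<and> (\<forall>x. scoeff 1 (\<rho> n) x = 0)" for n
  proof (induction n)
    case 0
    then show ?case by (simp add: scoeff_def assms(21) fps_mult_right_const_nth)
  next
    case (Suc n)
    then show ?case
      using formal_step.leading_density[OF step, of n r\<^sub>0 s]
        formal_step.first_order_density[OF step, of n r\<^sub>0 s] s_in
      by (simp add: assms(19))
  qed
  have rho0: "scoeff 0 (\<rho> n) x = r\<^sub>0" and rho1: "scoeff 1 (\<rho> n) x = 0" for n x
    using inv by auto
  note step_r0 = formal_step.leading_density[OF step rho0 rho1]
    and step_r1 = formal_step.first_order_density[OF step rho0 rho1]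
    and step_div = formal_step.leading_velocity_div_free[OF step rho0 rho1]
    and step_mom = formal_step.leading_momentum_balance[OF step rho0 rho1]
    and step_vel = formal_step.leading_velocity_balance[OF step rho0 rho1]
  \<comment> \<open>The data have no first-order density, so the divisor in the velocity equation is a constant.\<close>
  have \<rho>0: "\<rho>\<^sub>0 = fps_const r\<^sub>0"
    using assms(24)[of 0] by (simp only: rho0 rho1) simp
  have vel: "fps_const (vcoeff 0 (u\<^sub>s n i) x $ k) =
               fps_const (vcoeff 0 (u n) x $ k)
               - fps_const (t (Suc n) - t n) * (\<Sum>j=1..<i. fps_const (At i j) *
                   fps_const (tensor_divergence
                     (\<lambda>y. vcoeff 0 (u\<^sub>s n j) y \<otimes>\<^sub>v vcoeff 0 (u\<^sub>s n j) y) x $ k))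
               - fps_const (t (Suc n) - t n) / \<rho>\<^sub>0 * (\<Sum>j=1..i. fps_const (A i j) *
                   fps_const (grad (scoeff 2 (\<lambda>y. pressure \<kappa> \<gamma> (\<rho>\<^sub>s n j y))) x $ k))"
    if "i \<in> {1..s}" for n i x k
  proof -
    have sum_const: "(\<Sum>j\<in>J. fps_const (f j)) = fps_const (\<Sum>j\<in>J. f j)"
      for J :: "nat set" and f :: "nat \<Rightarrow> real"
      by (rule fps_ext) (simp add: fps_sum_nth)
    show ?thesis
      using arg_cong[OF step_vel[OF that, of n x], where f = "\<lambda>v. fps_const (v $ k)"]
      by (simp add: \<rho>0 fps_const_divide sum_const divide_inverse mult_ac)
  qed
  have div: "divergence (vcoeff 0 (u n)) x = 0" for n x
  proof (cases n)
    case 0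
    have "vcoeff 0 (u 0) = v\<^sub>0"
      by (rule ext) (simp add: vcoeff_def assms(22) vec_eq_iff)
    then show ?thesis using 0 assms(23) by simp
  next
    case (Suc m)
    then show ?thesis using step_div[OF s_in, of m x] by (simp add: assms(20))
  qed
  have mom: "imex_rk_step s At A bt b (t (Suc n) - t n) (scoeff 0 (\<rho> n) x *\<^sub>R vcoeff 0 (u n) x)
      (\<lambda>i. scoeff 0 (\<rho>\<^sub>s n i) x *\<^sub>R vcoeff 0 (u\<^sub>s n i) x)
      (\<lambda>j. - (scoeff 0 (\<rho>\<^sub>s n j) x *\<^sub>R tensor_divergence
          (\<lambda>y. vcoeff 0 (u\<^sub>s n j) y \<otimes>\<^sub>v vcoeff 0 (u\<^sub>s n j) y) x))
      (\<lambda>j. - grad (scoeff 2 (\<lambda>y. pressure \<kappa> \<gamma> (\<rho>\<^sub>s n j y))) x)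
      (scoeff 0 (\<rho> (Suc n)) x *\<^sub>R vcoeff 0 (u (Suc n)) x)" for n x
  proof -
    define F where "F j = - (scoeff 0 (\<rho>\<^sub>s n j) x *\<^sub>R tensor_divergence
          (\<lambda>y. vcoeff 0 (u\<^sub>s n j) y \<otimes>\<^sub>v vcoeff 0 (u\<^sub>s n j) y) x)" for j
    define G where "G j = - grad (scoeff 2 (\<lambda>y. pressure \<kappa> \<gamma> (\<rho>\<^sub>s n j y))) x" for j
    have stage: "scoeff 0 (\<rho>\<^sub>s n i) x *\<^sub>R vcoeff 0 (u\<^sub>s n i) x = scoeff 0 (\<rho> n) x *\<^sub>R vcoeff 0 (u n) x
        + (t (Suc n) - t n) *\<^sub>R (\<Sum>j=1..<i. At i j *\<^sub>R F j)
        + (t (Suc n) - t n) *\<^sub>R (\<Sum>j=1..i. A i j *\<^sub>R G j)" if i: "i \<in> {1..s}" for i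
    proof -
      have "(\<Sum>j=1..<i. At i j *\<^sub>R F j) = - (\<Sum>j=1..<i. At i j *\<^sub>R (r\<^sub>0 *\<^sub>R tensor_divergence
          (\<lambda>y. vcoeff 0 (u\<^sub>s n j) y \<otimes>\<^sub>v vcoeff 0 (u\<^sub>s n j) y) x))"
        unfolding sum_negf[symmetric] F_def using i by (intro sum.cong) (auto simp: step_r0)
      moreover have "(\<Sum>j=1..i. A i j *\<^sub>R G j) =
          - (\<Sum>j=1..i. A i j *\<^sub>R grad (scoeff 2 (\<lambda>y. pressure \<kappa> \<gamma> (\<rho>\<^sub>s n j y))) x)"
        unfolding sum_negf[symmetric] G_def by simp
      ultimately show ?thesis
        using step_mom[OF i, of n x] by (simp add: step_r0[OF i] rho0)
    qed
    \<comment> \<open>By global stiff accuracy the update is the last stage; its explicit sum stops at \<open>s - 1\<close>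
      because the explicit matrix is strictly lower triangular.\<close>
    have "(\<Sum>j=1..s. bt j *\<^sub>R F j) = (\<Sum>j=1..s. At s j *\<^sub>R F j)"
      by (intro sum.cong) (auto simp: b)
    also have "\<dots> = (\<Sum>j=1..<s. At s j *\<^sub>R F j)"
      using s At0 by (simp add: atLeastLessThanSuc_atLeastAtMost[symmetric])
    finally have bt_sum: "(\<Sum>j=1..s. bt j *\<^sub>R F j) = (\<Sum>j=1..<s. At s j *\<^sub>R F j)" .
    have b_sum: "(\<Sum>j=1..s. b j *\<^sub>R G j) = (\<Sum>j=1..s. A s j *\<^sub>R G j)"
      by (intro sum.cong) (auto simp: b)
    show ?thesis
      unfolding imex_rk_step_def F_def[symmetric] G_def[symmetric] bt_sum b_sum assms(19,20)
      using stage s_in by blast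
  qed
  have mass: "imex_rk_step s At A bt b (t (Suc n) - t n) (scoeff 0 (\<rho> n) x)
      (\<lambda>i. scoeff 0 (\<rho>\<^sub>s n i) x) (\<lambda>j. 0)
      (\<lambda>j. - (scoeff 0 (\<rho>\<^sub>s n j) x * divergence (vcoeff 0 (u\<^sub>s n j)) x)) (scoeff 0 (\<rho> (Suc n)) x)" for n x
    by (auto simp: imex_rk_step_def rho0 step_r0 step_div intro!: sum.neutral)
  show ?thesis
  proof (intro conjI allI ballI)
    fix n i x k assume i: "i \<in> {1..s}"
    show "\<exists>C. \<forall>x. scoeff 0 (\<rho>\<^sub>s n i) x = C" "\<exists>C. \<forall>x. scoeff 1 (\<rho>\<^sub>s n i) x = C"
      using step_r0[OF i] step_r1[OF i] by blast+
    show "fps_const (scoeff 0 (\<rho>\<^sub>s n i) x) + fps_X * fps_const (scoeff 1 (\<rho>\<^sub>s n i) x) = \<rho>\<^sub>0"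
      by (simp only: step_r0[OF i] step_r1[OF i] \<rho>0) simp
    show "divergence (vcoeff 0 (u\<^sub>s n i)) x = 0"
      by (rule step_div[OF i])
  next
    fix n
    show "imex_rk_incompressible_Euler s At A bt b (t (Suc n) - t n) r\<^sub>0
            (scoeff 0 (\<rho> n)) (vcoeff 0 (u n))
            (\<lambda>i. scoeff 0 (\<rho>\<^sub>s n i)) (\<lambda>i. vcoeff 0 (u\<^sub>s n i))
            (\<lambda>i. scoeff 2 (\<lambda>y. pressure \<kappa> \<gamma> (\<rho>\<^sub>s n i y)))
            (scoeff 0 (\<rho> (Suc n))) (vcoeff 0 (u (Suc n)))"
      unfolding imex_rk_incompressible_Euler_def
      using mass mom by (simp add: rho0 step_r0 step_div div)
  qed (rule vel)
qed

end
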